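(* For $\mathcal Z=\{z_1,\dots,z_K\}\subset\mathbb R^d$, $K\in\mathbb N$ fixed, assume that $\rho_0=(\rho_0(z_k))_{k=1}^K\in[0,\infty)^K$ satisfies $\min_{k=1,\dots,K}\rho_0(z_k)>0$. Consider data $D^{(n)}=(N^{(n)},Z^{(n)})\sim P^{(n)}_{\rho_0}$, with $Z$ a stationary ergodic random field taking values in $\mathcal Z$ with invariant measure $\nu$ such that $\min_{k=1,\dots,K}\nu(z_k)>0$. Let $\Pi$ be an absolutely continuous prior distribution on $[0,\infty)^K$, satisfying for all $k=1,\dots,K$ and some constants $b,C>0$, $$\Pi\left(\rho=(\rho(z_k))_{k=1}^K\in[0,\infty)^K:\ |\rho(z_k)|>u\right)\le Cu^{-b},\qquad u>0.$$ Then, for all sufficiently large $M>0$, as $n\to\infty$, $$E^{(n)}_{\rho_0}\left[\Pi\left(\rho:\ \sum_{k=1}^K|\rho(z_k)-\rho_0(z_k)|\,\nu(z_k)>M\frac{\sqrt{\log n}}{\sqrt n}\,\Bigg|\,D^{(n)}\right)\right]\to0.$$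
   Context: Observation model. Let $D,d\in\mathbb N$. $Z=(Z(x),\,x\in\mathbb R^D)$ is a jointly measurable $\mathcal Z$-valued random field, stationary with invariant distribution $\nu$. $(\mathcal W_n)_{n\ge1}$ are nonempty compact sets with $\mathcal W_n\subseteq\mathcal W_{n+1}\subset\mathbb R^D$ and, by convention, $\mathrm{vol}(\mathcal W_n)=n$. $Z^{(n)}:=(Z(x),\,x\in\mathcal W_n)$. A function $\rho:\mathcal Z\to[0,\infty)$ is identified with the vector $(\rho(z_k))_{k=1}^K\in[0,\infty)^K$. $P^{(n)}_\rho$ (with expectation $E^{(n)}_\rho$) is the joint law of $D^{(n)}=(N^{(n)},Z^{(n)})$, where conditionally on $Z^{(n)}$, $N^{(n)}$ is an inhomogeneous Poisson point process on $\mathcal W_n$ with intensity $x\mapsto\rho(Z(x))$. Likelihood: $L_n(\rho)=\exp\{\int_{\mathcal W_n}\log(\rho(Z(x)))\,dN^{(n)}(x)-\int_{\mathcal W_n}\rho(Z(x))\,dx\}$ (up to a factor not depending on $\rho$); the posterior is $\Pi(A|D^{(n)})=\int_AL_n\,d\Pi/\int L_n\,d\Pi$. Ergodicity is understood along the windows: in particular $\frac1n\int_{\mathcal W_n}1_{\{Z(x)=z_k\}}dx\to\nu(z_k)$ almost surely as $n\to\infty$.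
   Formalization: The prior is additionally assumed to have a Lebesgue density bounded below by a positive constant almost everywhere in a neighbourhood of ρ_0; without this the claim fails, e.g. K=1, ρ_0=1 and Π uniform on [5,6]. *)

theory Defs
  imports "HOL-Probability.Probability" "HOL-Library.Multiset"
begin

text \<open>The law of a field is taken on the product sigma-algebra of the path space, so equality
  of laws amounts to equality of all finite-dimensional distributions.\<close>

definition field_law ::
  "'w measure \<Rightarrow> ('a \<Rightarrow> 'w \<Rightarrow> 'b::topological_space) \<Rightarrow> ('a \<Rightarrow> 'b) measure"
  where "field_law Om Z = distr Om (PiM UNIV (\<lambda>_. borel)) (\<lambda>\<omega> x. Z x \<omega>)"

definition stationary_field ::
  "'w measure \<Rightarrow> ('a::real_vector \<Rightarrow> 'w \<Rightarrow> 'b::topological_space) \<Rightarrow> bool"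
  where "stationary_field Om Z \<longleftrightarrow> (\<forall>h. field_law Om (\<lambda>x. Z (x + h)) = field_law Om Z)"

text \<open>Invariance of an event is required only up to null sets for each shift: an event of the
  product sigma-algebra depends on countably many coordinates, so the strictly shift-invariant
  ones are just the empty set and the whole path space.\<close>

definition ergodic_field ::
  "'w measure \<Rightarrow> ('a::real_vector \<Rightarrow> 'w \<Rightarrow> 'b::topological_space) \<Rightarrow> bool"
  where "ergodic_field Om Z \<longleftrightarrow>
    (\<forall>A \<in> sets (PiM UNIV (\<lambda>_. borel)).
       (\<forall>h. AE \<omega> in Om. (\<lambda>x. Z (x + h) \<omega>) \<in> A \<longleftrightarrow> (\<lambda>x. Z x \<omega>) \<in> A) \<longrightarrow>
       measure Om {\<omega> \<in> space Om. (\<lambda>x. Z x \<omega>) \<in> A} \<in> {0, 1})"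

text \<open>A finite point configuration is a multiset of points, read as a counting measure.\<close>

definition npoints :: "'a multiset \<Rightarrow> 'a set \<Rightarrow> nat"
  where "npoints N B = size (filter_mset (\<lambda>x. x \<in> B) N)"

definition configs :: "'a::topological_space multiset measure"
  where "configs = sigma UNIV {{N. npoints N B = m} | B m. B \<in> sets borel}"

text \<open>The Poisson probabilities are spelled out because \<^const>\<open>poisson_pmf\<close> is specified only
  for a positive rate, whereas sets of intensity zero must carry no points.\<close>

definition poisson_process_law ::
  "'a::topological_space multiset measure \<Rightarrow> 'a measure \<Rightarrow> bool"
  where "poisson_process_law P \<Lambda> \<longleftrightarrow>
    prob_space P \<and> sets P = sets configs \<and>
    (\<forall>B \<in> sets borel. \<forall>m.
       measure P {N. npoints N B = m} = measure \<Lambda> B ^ m / fact m * exp (- measure \<Lambda> B)) \<and>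
    (\<forall>(B :: nat \<Rightarrow> 'a set) l.
       (\<forall>i<l. B i \<in> sets borel) \<longrightarrow> disjoint_family_on B {..<l} \<longrightarrow>
       prob_space.indep_vars P (\<lambda>_. count_space UNIV) (\<lambda>i N. npoints N (B i)) {..<l})"

text \<open>The function on \<open>range z\<close> corresponding to the vector \<open>r\<close>, i.e. \<open>z k \<mapsto> r $ k\<close>
  for injective \<open>z\<close>.\<close>

definition rate :: "('k \<Rightarrow> 'b) \<Rightarrow> real ^ 'k \<Rightarrow> 'b \<Rightarrow> real"
  where "rate z r y = r $ inv z y"

definition intensity ::
  "'a::euclidean_space set \<Rightarrow> ('k \<Rightarrow> 'b) \<Rightarrow> real ^ 'k \<Rightarrow> ('a \<Rightarrow> 'b) \<Rightarrow> 'a measure"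
  where "intensity W z r y = density lborel (\<lambda>x. ennreal (indicator W x * rate z r (y x)))"

text \<open>The joint law of point configuration and covariates. The field lives on \<open>Om\<close>, and
  \<open>\<kappa> \<omega>\<close> is the conditional law of the configuration given the field. The first
  component is sampled after \<open>\<omega>\<close>, so that the field itself cannot depend on the
  configuration. (Merely requiring, on a common space, a jointly measurable field and Poisson
  conditional distributions of the counts would still allow the field to be modified at the
  random points.)\<close>

definition joint_law ::
  "'w measure \<Rightarrow> ('w \<Rightarrow> 'a::topological_space multiset measure) \<Rightarrow> ('a multiset \<times> 'w) measure"
  where "joint_law Om \<kappa> =
    Om \<bind> (\<lambda>\<omega>. distr (\<kappa> \<omega>) (configs \<Otimes>\<^sub>M Om) (\<lambda>N. (N, \<omega>)))"

text \<open>The product is \<open>exp (\<integral> log (\<rho> (Z x)) dN x)\<close> under the convention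
  \<open>log 0 = -\<infinity>\<close>, which \<^const>\<open>ln\<close> does not follow.\<close>

definition likelihood ::
  "'a::euclidean_space set \<Rightarrow> ('k \<Rightarrow> 'b) \<Rightarrow> 'a multiset \<Rightarrow> ('a \<Rightarrow> 'b) \<Rightarrow> real ^ 'k \<Rightarrow> real"
  where "likelihood W z N y r =
    (\<Prod>x\<in>#N. rate z r (y x)) * exp (- (LINT x:W|lborel. rate z r (y x)))"

definition posterior :: "'p measure \<Rightarrow> ('p \<Rightarrow> real) \<Rightarrow> 'p set \<Rightarrow> ennreal"
  where "posterior Pr L A =
    (\<integral>\<^sup>+ r \<in> A. ennreal (L r) \<partial>Pr) / (\<integral>\<^sup>+ r. ennreal (L r) \<partial>Pr)"

end

theory Submission
  imports Defs "HOL-Real_Asymp.Real_Asymp"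
begin

text \<open>Given the field, the likelihood depends on the data only through the counts \<open>N\<^sub>k\<close> of points at
  which the field equals \<open>z k\<close>; these are Poisson with mean \<open>\<rho>0\<^sub>k V\<^sub>k\<close>, where \<open>V\<^sub>k \<ge> n \<nu>\<^sub>k / 2\<close> with
  probability tending to 1 by ergodicity. By Chebyshev, all deviations \<open>\<bar>N\<^sub>k - \<rho>0\<^sub>k V\<^sub>k\<bar>\<close> are at most
  \<open>sqrt (n ln n)\<close> up to probability \<open>O(1 / ln n)\<close>. On that event the likelihood ratio against \<open>\<rho>0\<close> is at most
  \<open>n powr (C1 - c M\<^sup>2)\<close> outside the \<open>M sqrt (ln n / n)\<close>-neighbourhood of \<open>\<rho>0\<close>, uniformly over the unbounded
  parameter space, whereas it is at least \<open>exp (- K)\<close> on the box \<open>[\<rho>0, \<rho>0 + 1/n]\<close>, of prior mass at least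
  of order \<open>n powr (- K)\<close>. So large \<open>M\<close> makes the posterior mass vanish without tests or a sieve.\<close>

section \<open>Integrating arbitrary functions against the joint law\<close>

text \<open>\<open>f\<close> need not be measurable: the nonnegative integral is a lower integral. This spares us the joint
  measurability of the posterior in the data.\<close>

lemma nn_integral_bind_le:
  assumes K: "K \<in> measurable M (subprob_algebra B)" and M: "space M \<noteq> {}"
  shows "(\<integral>\<^sup>+ x. f x \<partial>(M \<bind> K)) \<le> (\<integral>\<^sup>+ x. \<integral>\<^sup>+ y. f y \<partial>K x \<partial>M)"
proof -
  have sB: "sets (M \<bind> K) = sets B" by (rule sets_bind[OF sets_kernel[OF K] M])
  \<comment> \<open>A simple function below \<open>f\<close> is measurable, so the exact formula
    \<open>nn_integral_bind\<close> applies to it; \<open>f\<close> itself enters only through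
    monotonicity.\<close>
  have "integral\<^sup>S (M \<bind> K) g \<le> (\<integral>\<^sup>+ x. \<integral>\<^sup>+ y. f y \<partial>K x \<partial>M)"
    if g: "simple_function (M \<bind> K) g" "g \<le> f" for g
  proof -
    have mg: "g \<in> borel_measurable B"
      using borel_measurable_simple_function[OF g(1)] measurable_cong_sets[OF sB refl] by blast
    have "integral\<^sup>S (M \<bind> K) g = (\<integral>\<^sup>+ x. g x \<partial>(M \<bind> K))"
      by (rule nn_integral_eq_simple_integral[symmetric, OF g(1)])
    also have "\<dots> = (\<integral>\<^sup>+ x. \<integral>\<^sup>+ y. g y \<partial>K x \<partial>M)"
      by (rule nn_integral_bind[OF mg K])
    also have "\<dots> \<le> (\<integral>\<^sup>+ x. \<integral>\<^sup>+ y. f y \<partial>K x \<partial>M)"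
      using g(2) by (intro nn_integral_mono) (auto simp: le_fun_def)
    finally show ?thesis .
  qed
  then show ?thesis unfolding nn_integral_def[of "M \<bind> K"] by (auto intro!: SUP_least)
qed

lemma nn_integral_distr_le:
  assumes T: "T \<in> measurable M N"
  shows "(\<integral>\<^sup>+ x. f x \<partial>distr M N T) \<le> (\<integral>\<^sup>+ x. f (T x) \<partial>M)"
proof -
  have "integral\<^sup>S (distr M N T) g \<le> (\<integral>\<^sup>+ x. f (T x) \<partial>M)"
    if g: "simple_function (distr M N T) g" "g \<le> f" for g
  proof -
    have "integral\<^sup>S (distr M N T) g = (\<integral>\<^sup>+ x. g x \<partial>distr M N T)"
      by (rule nn_integral_eq_simple_integral[symmetric, OF g(1)])
    also have "\<dots> = (\<integral>\<^sup>+ x. g (T x) \<partial>M)"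
      using borel_measurable_simple_function[OF g(1)] by (intro nn_integral_distr T) auto
    also have "\<dots> \<le> (\<integral>\<^sup>+ x. f (T x) \<partial>M)"
      using g(2) by (intro nn_integral_mono) (auto simp: le_fun_def)
    finally show ?thesis .
  qed
  then show ?thesis unfolding nn_integral_def[of "distr M N T"] by (auto intro!: SUP_least)
qed

text \<open>The posterior expectation only has to be bounded from above, so this one-sided
  disintegration lets the rest of the argument work with one fixed path of the field at a
  time.\<close>

lemma nn_integral_joint_law_le:
  assumes \<kappa>: "\<kappa> \<in> measurable Om (prob_algebra configs)" and Om: "space Om \<noteq> {}"
  shows "(\<integral>\<^sup>+ (N, \<omega>). f N \<omega> \<partial>joint_law Om \<kappa>) \<le> (\<integral>\<^sup>+ \<omega>. \<integral>\<^sup>+ N. f N \<omega> \<partial>\<kappa> \<omega> \<partial>Om)"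
proof -
  have \<kappa>': "\<kappa> \<in> measurable Om (subprob_algebra configs)"
    by (rule measurable_prob_algebraD[OF \<kappa>])
  have kern: "(\<lambda>\<omega>. distr (\<kappa> \<omega>) (configs \<Otimes>\<^sub>M Om) (\<lambda>N. (N, \<omega>)))
      \<in> measurable Om (subprob_algebra (configs \<Otimes>\<^sub>M Om))"
    by (rule measurable_distr2[OF _ \<kappa>']) measurable
  have "(\<integral>\<^sup>+ (N, \<omega>). f N \<omega> \<partial>joint_law Om \<kappa>) \<le>
      (\<integral>\<^sup>+ \<omega>. \<integral>\<^sup>+ (N, \<omega>'). f N \<omega>' \<partial>distr (\<kappa> \<omega>) (configs \<Otimes>\<^sub>M Om) (\<lambda>N. (N, \<omega>)) \<partial>Om)"
    unfolding joint_law_def by (rule nn_integral_bind_le[OF kern Om])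
  also have "\<dots> \<le> (\<integral>\<^sup>+ \<omega>. \<integral>\<^sup>+ N. f N \<omega> \<partial>\<kappa> \<omega> \<partial>Om)"
  proof (rule nn_integral_mono)
    fix \<omega> assume w: "\<omega> \<in> space Om"
    have "sets (\<kappa> \<omega>) = sets configs" by (rule sets_kernel[OF \<kappa>' w])
    then have "(\<lambda>N. (N, \<omega>)) \<in> measurable (\<kappa> \<omega>) (configs \<Otimes>\<^sub>M Om)"
      using w measurable_cong_sets by fastforce
    from nn_integral_distr_le[OF this, of "\<lambda>(N, \<omega>'). f N \<omega>'"]
    show "(\<integral>\<^sup>+ (N, \<omega>'). f N \<omega>' \<partial>distr (\<kappa> \<omega>) (configs \<Otimes>\<^sub>M Om) (\<lambda>N. (N, \<omega>)))
        \<le> (\<integral>\<^sup>+ N. f N \<omega> \<partial>\<kappa> \<omega>)" by simp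
  qed
  finally show ?thesis .
qed

section \<open>Poisson counts: variance and Chebyshev bound\<close>

lemma poisson_second_moment_sums:
  fixes l :: real
  shows "(\<lambda>m. (real m - l)\<^sup>2 * (l ^ m / fact m * exp (- l))) sums l"
proof -
  define p where "p m = l ^ m / fact m" for m :: nat
  have p0: "p sums exp l"
    using exp_converges[of l] by (simp add: p_def[abs_def] divide_inverse mult.commute)
  \<comment> \<open>Both moments come from this shift: \<open>real m * p m\<close> and
    \<open>real m * (real m * p m)\<close> vanish at 0, so their series may start at
    \<open>Suc m\<close>, where one factor \<open>real (Suc m)\<close> turns
    \<open>p (Suc m)\<close> into \<open>l * p m\<close>.\<close>
  have pS: "real (Suc m) * p (Suc m) = l * p m" for m
    by (simp add: p_def)
  have p1: "(\<lambda>m. real m * p m) sums (l * exp l)"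
    using sums_mult[OF p0, of l] sums_Suc_iff[of "\<lambda>m. real m * p m" "l * exp l"]
    unfolding pS by simp
  have "(\<lambda>m. real (Suc m) * (real (Suc m) * p (Suc m))) sums (l * (l * exp l + exp l))"
    unfolding pS using sums_mult[OF sums_add[OF p1 p0], of l] by (simp add: algebra_simps)
  then have p2: "(\<lambda>m. real m * (real m * p m)) sums (l * (l * exp l + exp l))"
    using sums_Suc_iff[of "\<lambda>m. real m * (real m * p m)"] by simp
  have "(\<lambda>m. (real m * (real m * p m) - 2 * l * (real m * p m) + l\<^sup>2 * p m) * exp (- l)) sums
      ((l * (l * exp l + exp l) - 2 * l * (l * exp l) + l\<^sup>2 * exp l) * exp (- l))"
    by (intro sums_mult2 sums_add sums_diff sums_mult p0 p1 p2)
  moreover have "(l * (l * exp l + exp l) - 2 * l * (l * exp l) + l\<^sup>2 * exp l) * exp (- l) = l"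
    by (simp add: algebra_simps power2_eq_square exp_minus_inverse)
  moreover have "(real m * (real m * p m) - 2 * l * (real m * p m) + l\<^sup>2 * p m) * exp (- l) =
      (real m - l)\<^sup>2 * (l ^ m / fact m * exp (- l))" for m
    by (simp add: p_def power2_eq_square algebra_simps diff_divide_distrib add_divide_distrib)
  ultimately show ?thesis by simp
qed

lemma npoints_sets:
  assumes "sets P = sets configs" "B \<in> sets borel"
  shows "{N. npoints N B = m} \<in> sets P"
  unfolding assms(1) configs_def using assms(2) by (auto intro!: sigma_sets.Basic)

text \<open>The law of a count is given through the probabilities of its single values, so the
  deviation event is cut into the events of one exact count, and the variance series dominates their
  probabilities term by term.\<close>

lemma poisson_process_chebyshev:
  assumes P: "poisson_process_law P \<Lambda>" and B: "B \<in> sets borel" and t: "t > 0"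
  shows "{N. \<bar>real (npoints N B) - measure \<Lambda> B\<bar> > t} \<in> sets P"
    and "emeasure P {N. \<bar>real (npoints N B) - measure \<Lambda> B\<bar> > t} \<le> ennreal (measure \<Lambda> B / t\<^sup>2)"
proof -
  define l where "l = measure \<Lambda> B"
  define A where "A m = (if \<bar>real m - l\<bar> > t then {N. npoints N B = m} else {})" for m
  have P1: "prob_space P" "sets P = sets configs"
    and P2: "\<And>m. measure P {N. npoints N B = m} = l ^ m / fact m * exp (- l)"
    using P B unfolding poisson_process_law_def l_def by auto
  interpret prob_space P by (rule P1(1))
  have A: "A m \<in> sets P" for m
    unfolding A_def using npoints_sets[OF P1(2) B] by simp
  have eq: "{N. \<bar>real (npoints N B) - l\<bar> > t} = (\<Union>m. A m)"
    unfolding A_def by auto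
  show "{N. \<bar>real (npoints N B) - measure \<Lambda> B\<bar> > t} \<in> sets P"
    using A eq unfolding l_def by auto
  have S: "(\<lambda>m. (real m - l)\<^sup>2 * (l ^ m / fact m * exp (- l)) / t\<^sup>2) sums (l / t\<^sup>2)"
    by (intro sums_divide poisson_second_moment_sums)
  have l0: "l \<ge> 0" unfolding l_def by simp
  have "emeasure P (A m) \<le> ennreal ((real m - l)\<^sup>2 * (l ^ m / fact m * exp (- l)) / t\<^sup>2)" for m
  proof (cases "\<bar>real m - l\<bar> > t")
    case True
    have "1 \<le> (real m - l)\<^sup>2 / t\<^sup>2"
      using True t by (simp add: abs_le_square_iff[symmetric])
    then have "1 * (l ^ m / fact m * exp (- l)) \<le> (real m - l)\<^sup>2 / t\<^sup>2 * (l ^ m / fact m * exp (- l))"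
      using l0 by (intro mult_right_mono) auto
    then show ?thesis
      using True P2[of m] by (auto simp: A_def emeasure_eq_measure mult_ac intro!: ennreal_leI)
  qed (simp add: A_def)
  then have "(\<Sum>m. emeasure P (A m)) \<le>
      (\<Sum>m. ennreal ((real m - l)\<^sup>2 * (l ^ m / fact m * exp (- l)) / t\<^sup>2))"
    by (intro suminf_le) auto
  also have "\<dots> = ennreal (l / t\<^sup>2)"
    using S l0 by (subst suminf_ennreal_eq[OF _ S]) auto
  finally have "emeasure P (\<Union>m. A m) \<le> ennreal (l / t\<^sup>2)"
    using A emeasure_subadditive_countably[of A P] by (auto intro: order_trans)
  then show "emeasure P {N. \<bar>real (npoints N B) - measure \<Lambda> B\<bar> > t} \<le> ennreal (measure \<Lambda> B / t\<^sup>2)"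
    using eq unfolding l_def by simp
qed

section \<open>Likelihood ratio bounds for one count\<close>

text \<open>The left side is the ratio of the Poisson likelihoods with means \<open>u * l\<close>
  and \<open>l\<close>. With h = sqrt u - 1 and \<xi> = m - l, bounding ln u by 2 h turns the
  exponent into 2 \<xi> h - l h^2, since u - 1 = h^2 + 2 h. Completing the square then trades half
  of l h^2 for 2 \<xi>^2 / l. The bound covers all u >= 0 and decays as u grows, which makes an
  unbounded parameter space harmless.\<close>

lemma poisson_ratio_le:
  fixes u l :: real
  assumes u: "u \<ge> 0" and l: "l > 0"
  shows "u ^ m * exp (- l * (u - 1)) \<le> exp (2 * (real m - l)\<^sup>2 / l - l * (sqrt u - 1)\<^sup>2 / 2)"
proof -
  define h where "h = sqrt u - 1"
  define \<xi> where "\<xi> = real m - l"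
  have uh: "u = (h + 1)\<^sup>2" unfolding h_def using u by simp
  \<comment> \<open>\<open>ln u \<le> 2 (sqrt u - 1)\<close>, in a form that also covers \<open>u = 0\<close>\<close>
  have "sqrt u \<le> exp h" unfolding h_def using exp_ge_add_one_self[of "sqrt u - 1"] by simp
  then have "sqrt u ^ (2 * m) \<le> exp h ^ (2 * m)" using u by (intro power_mono) auto
  moreover have "sqrt u ^ (2 * m) = u ^ m" using u by (simp add: power_mult)
  moreover have "exp h ^ (2 * m) = exp (2 * real m * h)" by (simp add: exp_of_nat_mult[symmetric])
  ultimately have "u ^ m \<le> exp (2 * real m * h)" by simp
  then have "u ^ m * exp (- l * (u - 1)) \<le> exp (2 * real m * h) * exp (- l * (u - 1))"
    by (intro mult_right_mono) auto
  also have "\<dots> = exp (2 * \<xi> * h - l * h\<^sup>2)"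
    unfolding exp_add[symmetric] uh \<xi>_def by (simp add: algebra_simps power2_eq_square)
  also have "\<dots> \<le> exp (2 * \<xi>\<^sup>2 / l - l * h\<^sup>2 / 2)"
  proof -
    have "0 \<le> (2 * \<xi> - l * h)\<^sup>2 / (2 * l)" using l by simp
    also have "\<dots> = 2 * \<xi>\<^sup>2 / l - 2 * \<xi> * h + l * h\<^sup>2 / 2"
      using l by (simp add: field_simps power2_eq_square)
    finally show ?thesis by simp
  qed
  finally show ?thesis unfolding h_def \<xi>_def .
qed

text \<open>With h = sqrt u - 1 one has u - 1 = h (h + 2). If |h| were below \<eta> / 3 <= 1/3, then
  |h + 2| <= 3 would force |u - 1| <= 3 |h| < \<eta>; hence the constant 9 = 3^2.\<close>

lemma sqrt_deviation:
  fixes u \<eta> :: real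
  assumes "u \<ge> 0" "\<bar>u - 1\<bar> > \<eta>" "0 \<le> \<eta>" "\<eta> \<le> 1"
  shows "(sqrt u - 1)\<^sup>2 \<ge> \<eta>\<^sup>2 / 9"
proof -
  define h where "h = sqrt u - 1"
  have uh: "u - 1 = h * (h + 2)"
    unfolding h_def using assms(1) by (simp add: algebra_simps)
  have "\<eta> / 3 \<le> \<bar>h\<bar>"
  proof (rule ccontr)
    assume n: "\<not> \<eta> / 3 \<le> \<bar>h\<bar>"
    then have "\<bar>h\<bar> * \<bar>h + 2\<bar> \<le> \<bar>h\<bar> * 3" using assms(4) by (intro mult_left_mono) auto
    then show False using n assms(2) unfolding uh by (simp add: abs_mult)
  qed
  then have "(\<eta> / 3)\<^sup>2 \<le> \<bar>h\<bar>\<^sup>2" using assms(3) by (intro power_mono) auto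
  then show ?thesis unfolding h_def by (simp add: power_divide)
qed

section \<open>Bounds on the posterior mass of a set\<close>

text \<open>If the normalising integral is 0 or \<top>, the quotient is 0 in \<open>ennreal\<close>,
  so degenerate likelihoods do no harm.\<close>

lemma posterior_le_1: "posterior Pr L A \<le> 1"
proof -
  have "(\<integral>\<^sup>+ r \<in> A. ennreal (L r) \<partial>Pr) \<le> (\<integral>\<^sup>+ r. ennreal (L r) \<partial>Pr)"
    by (intro nn_integral_mono) (auto simp: indicator_def)
  then show ?thesis unfolding posterior_def
    by (cases "(\<integral>\<^sup>+ r. ennreal (L r) \<partial>Pr) = 0"; cases "(\<integral>\<^sup>+ r. ennreal (L r) \<partial>Pr) = \<top>")
      (auto intro!: divide_le_posI_ennreal simp: zero_less_iff_neq_zero)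
qed

text \<open>\<open>l\<close> stands for a reference likelihood, later that of the true parameter,
  and cancels in the quotient. The numerator is bounded with the total prior mass 1, the denominator
  with the mass of \<open>B\<close> alone. The upper bound is asked almost everywhere because it
  will hold for nonnegative rates.\<close>

lemma posterior_le:
  assumes "prob_space Pr" and B: "B \<in> sets Pr" "emeasure Pr B \<ge> ennreal p"
    and pos: "p > 0" "d > 0" "l > 0" "a \<ge> 0"
    and up: "AE r in Pr. r \<in> A \<longrightarrow> L r \<le> a * l"
    and lo: "\<And>r. r \<in> B \<Longrightarrow> L r \<ge> d * l"
  shows "posterior Pr L A \<le> ennreal (a / (d * p))"
proof -
  interpret prob_space Pr by fact
  have "(\<integral>\<^sup>+ r \<in> A. ennreal (L r) \<partial>Pr) \<le> (\<integral>\<^sup>+ r. ennreal (a * l) \<partial>Pr)"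
    using up by (intro nn_integral_mono_AE) (auto simp: indicator_def intro: ennreal_leI)
  then have num: "(\<integral>\<^sup>+ r \<in> A. ennreal (L r) \<partial>Pr) \<le> ennreal (a * l)"
    by (simp add: emeasure_space_1)
  have "ennreal (d * l * p) = ennreal (d * l) * ennreal p"
    using pos by (simp add: ennreal_mult)
  also have "\<dots> \<le> ennreal (d * l) * emeasure Pr B" by (intro mult_left_mono B) auto
  also have "\<dots> = (\<integral>\<^sup>+ r. ennreal (d * l) * indicator B r \<partial>Pr)"
    using B by (simp add: nn_integral_cmult_indicator)
  also have "\<dots> \<le> (\<integral>\<^sup>+ r. ennreal (L r) \<partial>Pr)"
    using lo by (intro nn_integral_mono) (auto simp: indicator_def intro: ennreal_leI)
  finally have den: "ennreal (d * l * p) \<le> (\<integral>\<^sup>+ r. ennreal (L r) \<partial>Pr)" .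
  have "ennreal (a * l) = ennreal (d * l * p) * ennreal (a / (d * p))"
    using pos by (simp add: ennreal_mult[symmetric])
  also have "\<dots> \<le> (\<integral>\<^sup>+ r. ennreal (L r) \<partial>Pr) * ennreal (a / (d * p))"
    by (intro mult_right_mono den) simp
  finally have "ennreal (a * l) \<le> (\<integral>\<^sup>+ r. ennreal (L r) \<partial>Pr) * ennreal (a / (d * p))" .
  moreover have "0 < (\<integral>\<^sup>+ r. ennreal (L r) \<partial>Pr)"
    using pos by (intro less_le_trans[OF _ den]) simp
  ultimately show ?thesis
    unfolding posterior_def using num by (intro divide_le_posI_ennreal) auto
qed


section \<open>Reduction of the likelihood to one count per field value\<close>

lemma rate_range: "inj z \<Longrightarrow> rate z r (z k) = r $ k"
  by (simp add: rate_def)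

lemma indicator_times_rate_eq_sum:
  fixes z :: "'k::finite \<Rightarrow> 'b"
  assumes z: "inj z" and y: "range y \<subseteq> range z"
  shows "indicator W x * rate z r (y x) = (\<Sum>k\<in>UNIV. indicat_real (W \<inter> y -` {z k}) x * r $ k)"
proof -
  obtain j where j: "y x = z j" using y by blast
  have "indicat_real (W \<inter> y -` {z k}) x * r $ k = (if k = j then indicator W x * r $ j else 0)" for k
    using j z by (auto simp: indicator_def inj_eq)
  then show ?thesis using j by (simp add: rate_range[OF z])
qed

text \<open>The counts are taken over the whole level set, not its part inside \<open>W\<close>,
  because the product in \<open>likelihood\<close> runs over every point of \<open>N\<close>; the
  window enters through the volumes.\<close>

lemma likelihood_eq_prod:
  fixes z :: "'k::finite \<Rightarrow> 'b" and y :: "'a::euclidean_space \<Rightarrow> 'b"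
  assumes z: "inj z" and y: "range y \<subseteq> range z" and m: "\<And>k. y -` {z k} \<in> sets borel"
    and W: "compact W"
  shows "likelihood W z N y r = (\<Prod>k\<in>UNIV. (r $ k) ^ npoints N (y -` {z k}) *
    exp (- (r $ k * measure lborel (W \<inter> y -` {z k}))))"
proof -
  have P: "(\<Prod>x\<in>#N. rate z r (y x)) = (\<Prod>k\<in>UNIV. (r $ k) ^ npoints N (y -` {z k}))"
  proof (induction N)
    case empty
    then show ?case by (simp add: npoints_def)
  next
    case (add x N)
    obtain j where j: "y x = z j" using y by blast
    have "npoints (add_mset x N) (y -` {z k}) = npoints N (y -` {z k}) + (if k = j then 1 else 0)" for k
      using j z by (auto simp: npoints_def inj_eq)
    then have "(\<Prod>k\<in>UNIV. (r $ k) ^ npoints (add_mset x N) (y -` {z k})) =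
        (\<Prod>k\<in>UNIV. (r $ k) ^ npoints N (y -` {z k}) * (if k = j then r $ k else 1))"
      by (intro prod.cong) auto
    also have "\<dots> = (\<Prod>k\<in>UNIV. (r $ k) ^ npoints N (y -` {z k})) * r $ j"
      by (simp add: prod.distrib)
    finally show ?case using add j by (simp add: rate_range[OF z])
  qed
  have Wm: "W \<inter> y -` {z k} \<in> sets lborel" for k
    using m[of k] compact_imp_closed[OF W] by auto
  have Wf: "emeasure lborel (W \<inter> y -` {z k}) < \<infinity>" for k
  proof -
    have "emeasure lborel (W \<inter> y -` {z k}) \<le> emeasure lborel W"
      using compact_imp_closed[OF W] by (intro emeasure_mono) auto
    also have "\<dots> < \<infinity>" using emeasure_bounded_finite compact_imp_bounded[OF W] by auto
    finally show ?thesis .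
  qed
  have "(LINT x:W|lborel. rate z r (y x)) =
      (LINT x|lborel. (\<Sum>k\<in>UNIV. indicat_real (W \<inter> y -` {z k}) x * r $ k))"
    unfolding set_lebesgue_integral_def real_scaleR_def indicator_times_rate_eq_sum[OF z y] ..
  also have "\<dots> = (\<Sum>k\<in>UNIV. LINT x|lborel. indicat_real (W \<inter> y -` {z k}) x * r $ k)"
    using Wm Wf by (intro Bochner_Integration.integral_sum integrable_mult_left integrable_real_indicator) auto
  also have "\<dots> = (\<Sum>k\<in>UNIV. r $ k * measure lborel (W \<inter> y -` {z k}))"
    by (intro sum.cong) (auto simp: mult.commute)
  finally show ?thesis
    unfolding likelihood_def P by (simp add: prod.distrib exp_sum sum_negf[symmetric])
qed

lemma measure_intensity_level_set:
  fixes z :: "'k::finite \<Rightarrow> 'b" and y :: "'a::euclidean_space \<Rightarrow> 'b"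
  assumes z: "inj z" and y: "range y \<subseteq> range z" and m: "\<And>k. y -` {z k} \<in> sets borel"
    and W: "compact W" and r: "\<And>k. r $ k \<ge> 0"
  shows "measure (intensity W z r y) (y -` {z k}) = r $ k * measure lborel (W \<inter> y -` {z k})"
proof -
  have Wb: "W \<in> sets borel" using compact_imp_closed[OF W] by auto
  note sum_eq = indicator_times_rate_eq_sum[OF z y]
  \<comment> \<open>Measurability is known for the level sets of \<open>y\<close>, so that of the
    density goes through its representation as a finite sum.\<close>
  have "(\<lambda>x. ennreal (\<Sum>k\<in>UNIV. indicat_real (W \<inter> y -` {z k}) x * r $ k)) \<in> borel_measurable lborel"
    using m Wb
    by (intro measurable_compose[OF _ measurable_ennreal] borel_measurable_sum borel_measurable_times
      borel_measurable_indicator) auto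
  then have M: "(\<lambda>x. ennreal (indicator W x * rate z r (y x))) \<in> borel_measurable lborel"
    unfolding sum_eq .
  have "emeasure (intensity W z r y) (y -` {z k}) =
      (\<integral>\<^sup>+ x. ennreal (indicator W x * rate z r (y x)) * indicator (y -` {z k}) x \<partial>lborel)"
    unfolding intensity_def using M m[of k] by (intro emeasure_density) auto
  also have "\<dots> = (\<integral>\<^sup>+ x. ennreal (r $ k) * indicator (W \<inter> y -` {z k}) x \<partial>lborel)"
    by (intro nn_integral_cong) (auto simp: indicator_def rate_range[OF z])
  also have "\<dots> = ennreal (r $ k) * emeasure lborel (W \<inter> y -` {z k})"
    using m[of k] Wb by (intro nn_integral_cmult_indicator) auto
  finally show ?thesis
    using r[of k] by (simp add: measure_def enn2real_mult)
qed

section \<open>Prior mass near the truth\<close>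

lemma One_cart_nth: "(One :: real ^ 'k::finite) $ k = 1"
  by (simp add: cart_eq_inner_axis inner_sum_left_Basis axis_in_Basis_iff)

lemma prior_box_mass:
  fixes Pr :: "(real ^ 'k::finite) measure"
  assumes Pr_sets: "sets Pr = sets borel" and Pr_ac: "absolutely_continuous lborel Pr"
    and dens: "AE r in lborel. r \<in> ball \<rho>0 \<epsilon> \<longrightarrow> RN_deriv lborel Pr r \<ge> ennreal c"
    and c: "c > 0" and h: "h > 0" "real CARD('k) * h < \<epsilon>"
  shows "emeasure Pr (cbox \<rho>0 (\<rho>0 + h *\<^sub>R One)) \<ge> ennreal (c * h ^ CARD('k))"
proof -
  let ?B = "cbox \<rho>0 (\<rho>0 + h *\<^sub>R One)"
  have sub: "?B \<subseteq> ball \<rho>0 \<epsilon>"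
  proof
    fix r assume r: "r \<in> ?B"
    \<comment> \<open>The l1 distance from \<open>\<rho>0\<close> within the box is at most
      \<open>CARD('k) * h\<close>, which explains the second condition in \<open>h\<close>.\<close>
    have "norm (r - \<rho>0) \<le> (\<Sum>k\<in>UNIV. \<bar>(r - \<rho>0) $ k\<bar>)" by (rule norm_le_l1_cart)
    also have "\<dots> \<le> (\<Sum>k\<in>(UNIV::'k set). h)"
    proof (rule sum_mono)
      fix k
      show "\<bar>(r - \<rho>0) $ k\<bar> \<le> h" using r One_cart_nth[of k] by (auto simp: mem_box_cart dest!: spec[of _ k])
    qed
    finally show "r \<in> ball \<rho>0 \<epsilon>" using h(2) by (simp add: dist_norm norm_minus_commute)
  qed
  have "emeasure lborel ?B = ennreal (h ^ CARD('k))"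
    using h by (subst emeasure_lborel_cbox) (auto simp: inner_add_left)
  then have "ennreal (c * h ^ CARD('k)) = ennreal c * emeasure lborel ?B"
    using c h by (simp add: ennreal_mult)
  also have "\<dots> = (\<integral>\<^sup>+ r. ennreal c * indicator ?B r \<partial>lborel)"
    by (simp add: nn_integral_cmult_indicator)
  also have "\<dots> \<le> (\<integral>\<^sup>+ r. RN_deriv lborel Pr r * indicator ?B r \<partial>lborel)"
    using dens sub by (intro nn_integral_mono_AE) (auto simp: indicator_def elim!: eventually_mono)
  also have "\<dots> = emeasure (density lborel (RN_deriv lborel Pr)) ?B"
    by (intro emeasure_density[symmetric]) auto
  also have "\<dots> = emeasure Pr ?B"
    using Pr_ac Pr_sets by (simp add: sigma_finite_measure.density_RN_deriv[OF sigma_finite_lborel])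
  finally show ?thesis .
qed

section \<open>Likelihood ratio bounds over all coordinates\<close>

text \<open>This is \<open>poisson_ratio_le\<close> with u = r / \<rho> and l = \<rho> V, kept in
  product form so that it can be multiplied over the coordinates.\<close>

lemma poisson_likelihood_le:
  fixes \<rho> V r :: real
  assumes "\<rho> > 0" "V > 0" "r \<ge> 0"
  shows "r ^ m * exp (- (r * V)) \<le> exp (2 * (real m - \<rho> * V)\<^sup>2 / (\<rho> * V) -
    \<rho> * V * (sqrt (r / \<rho>) - 1)\<^sup>2 / 2) * (\<rho> ^ m * exp (- (\<rho> * V)))"
proof -
  have "r ^ m * exp (- (r * V)) =
      (r / \<rho>) ^ m * exp (- (\<rho> * V) * (r / \<rho> - 1)) * (\<rho> ^ m * exp (- (\<rho> * V)))"
  proof -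
    have "- (r * V) = - (\<rho> * V) * (r / \<rho> - 1) + - (\<rho> * V)"
      using assms(1) by (simp add: field_simps)
    then have "exp (- (r * V)) = exp (- (\<rho> * V) * (r / \<rho> - 1)) * exp (- (\<rho> * V))"
      by (simp only: exp_add)
    then show ?thesis using assms(1) by (simp add: power_divide)
  qed
  also have "\<dots> \<le> exp (2 * (real m - \<rho> * V)\<^sup>2 / (\<rho> * V) -
    \<rho> * V * (sqrt (r / \<rho>) - 1)\<^sup>2 / 2) * (\<rho> ^ m * exp (- (\<rho> * V)))"
    using assms by (intro mult_right_mono poisson_ratio_le) auto
  finally show ?thesis .
qed

text \<open>As V k >= n \<nu> k / 2, the deviations of the counts cost at most 4 L / (\<rho>0 \<nu>)
  per coordinate. A total distance above the threshold forces one coordinate to exceed a share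
  \<open>1 / CARD('k)\<close> of it, and this coordinate supplies the negative term: 36 collects the
  1/2 of \<open>poisson_ratio_le\<close>, the 1/2 in the bound on \<open>V\<close> and the 1/9 of
  \<open>sqrt_deviation\<close>.\<close>

lemma poisson_likelihood_prod_le:
  fixes \<rho>0 r :: "real ^ 'k::finite" and \<nu> V :: "'k \<Rightarrow> real" and m :: "'k \<Rightarrow> nat"
  assumes \<rho>0: "\<And>k. \<rho>0 $ k > 0" and r: "\<And>k. r $ k \<ge> 0" and \<nu>: "\<And>k. \<nu> k > 0"
    and n: "n > 0" and L: "L \<ge> 0" and M: "M \<ge> 0"
    and V: "\<And>k. V k \<ge> n * \<nu> k / 2"
    and m: "\<And>k. \<bar>real (m k) - \<rho>0 $ k * V k\<bar> \<le> sqrt (n * L)"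
    and small: "\<And>k. M * sqrt L / sqrt n \<le> real CARD('k) * \<nu> k * \<rho>0 $ k"
    and far: "(\<Sum>k\<in>UNIV. \<bar>r $ k - \<rho>0 $ k\<bar> * \<nu> k) > M * sqrt L / sqrt n"
  shows "(\<Prod>k\<in>UNIV. (r $ k) ^ m k * exp (- (r $ k * V k))) \<le>
    exp (((\<Sum>k\<in>UNIV. 4 / (\<rho>0 $ k * \<nu> k)) -
          M\<^sup>2 / (36 * (real CARD('k))\<^sup>2 * (\<Sum>k\<in>UNIV. \<rho>0 $ k * \<nu> k))) * L) *
    (\<Prod>k\<in>UNIV. (\<rho>0 $ k) ^ m k * exp (- (\<rho>0 $ k * V k)))"
proof -
  define K D S where "K = real CARD('k)" and "D = M * sqrt L / sqrt n"
    and "S = (\<Sum>k\<in>UNIV. \<rho>0 $ k * \<nu> k)"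
  define e where "e k = 2 * (real (m k) - \<rho>0 $ k * V k)\<^sup>2 / (\<rho>0 $ k * V k)" for k
  define f where "f k = \<rho>0 $ k * V k * (sqrt (r $ k / \<rho>0 $ k) - 1)\<^sup>2 / 2" for k
  have K: "K > 0" unfolding K_def by simp
  have Vp: "V k > 0" for k
  proof -
    have "0 < n * \<nu> k / 2" using n \<nu> by simp
    then show ?thesis using V[of k] by linarith
  qed
  have f0: "f k \<ge> 0" for k unfolding f_def using \<rho>0[of k] Vp[of k] by simp
  have e: "e k \<le> 4 / (\<rho>0 $ k * \<nu> k) * L" for k
  proof -
    have "(real (m k) - \<rho>0 $ k * V k)\<^sup>2 \<le> (sqrt (n * L))\<^sup>2"
      using power_mono[OF m[of k], of 2] by simp
    then have "e k \<le> 2 * (n * L) / (\<rho>0 $ k * V k)"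
      unfolding e_def using n L \<rho>0[of k] Vp[of k] by (intro divide_right_mono) auto
    also have "\<dots> \<le> 2 * (n * L) / (\<rho>0 $ k * (n * \<nu> k / 2))"
      using n L \<rho>0[of k] Vp[of k] V[of k] \<nu>[of k] by (intro divide_left_mono mult_left_mono) auto
    also have "\<dots> = 4 / (\<rho>0 $ k * \<nu> k) * L" using n by simp
    finally show ?thesis .
  qed
  obtain j where j: "\<bar>r $ j - \<rho>0 $ j\<bar> * \<nu> j > D / K"
  proof -
    have False if "\<And>k. \<bar>r $ k - \<rho>0 $ k\<bar> * \<nu> k \<le> D / K"
    proof -
      have "(\<Sum>k\<in>UNIV. \<bar>r $ k - \<rho>0 $ k\<bar> * \<nu> k) \<le> K * (D / K)"
        unfolding K_def using that[unfolded K_def] by (intro sum_bounded_above) auto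
      then show False using far K unfolding D_def by simp
    qed
    then show ?thesis using that by (meson not_le)
  qed
  \<comment> \<open>A lower bound for the relative deviation at \<open>j\<close>;
    \<open>small\<close> keeps it at most 1, as \<open>sqrt_deviation\<close> requires.\<close>
  define \<eta> where "\<eta> = D / (K * \<nu> j * \<rho>0 $ j)"
  have "(sqrt (r $ j / \<rho>0 $ j) - 1)\<^sup>2 \<ge> \<eta>\<^sup>2 / 9"
  proof (rule sqrt_deviation)
    show "r $ j / \<rho>0 $ j \<ge> 0" using r[of j] \<rho>0[of j] by simp
    have "\<bar>r $ j / \<rho>0 $ j - 1\<bar> = \<bar>r $ j - \<rho>0 $ j\<bar> / \<rho>0 $ j"
      using \<rho>0[of j] by (simp add: abs_if field_simps)
    then show "\<eta> < \<bar>r $ j / \<rho>0 $ j - 1\<bar>"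
      unfolding \<eta>_def using j \<rho>0[of j] \<nu>[of j] K by (simp add: field_simps)
    show "0 \<le> \<eta>" unfolding \<eta>_def D_def using M L n \<rho>0[of j] \<nu>[of j] K by simp
    have "D \<le> K * \<nu> j * \<rho>0 $ j" "0 < K * \<nu> j * \<rho>0 $ j"
      using small[of j] \<rho>0[of j] \<nu>[of j] K by (simp_all add: D_def K_def)
    then show "\<eta> \<le> 1" unfolding \<eta>_def by simp
  qed
  then have "(\<rho>0 $ j * (n * \<nu> j / 2)) * (\<eta>\<^sup>2 / 9) \<le> (\<rho>0 $ j * V j) * (sqrt (r $ j / \<rho>0 $ j) - 1)\<^sup>2"
    using n \<rho>0[of j] \<nu>[of j] V[of j] Vp[of j] by (intro mult_mono) auto
  then have "f j \<ge> n * D\<^sup>2 / (36 * K\<^sup>2 * (\<rho>0 $ j * \<nu> j))"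
    unfolding f_def \<eta>_def using n \<rho>0[of j] \<nu>[of j] K
    by (simp add: power_divide power_mult_distrib power2_eq_square mult_ac)
  moreover have "n * D\<^sup>2 = M\<^sup>2 * L"
    unfolding D_def using n L by (simp add: power_mult_distrib power_divide)
  \<comment> \<open>The index \<open>j\<close> depends on \<open>r\<close>; passing from its term to
    the sum \<open>S\<close> makes the exponent uniform in \<open>r\<close>.\<close>
  moreover have "M\<^sup>2 * L / (36 * K\<^sup>2 * S) \<le> M\<^sup>2 * L / (36 * K\<^sup>2 * (\<rho>0 $ j * \<nu> j))"
  proof -
    have "\<rho>0 $ j * \<nu> j \<le> S" unfolding S_def
      using \<rho>0 \<nu> by (intro member_le_sum) (auto simp: less_imp_le)
    moreover have "0 < \<rho>0 $ j * \<nu> j" using \<rho>0 \<nu> by simp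
    moreover from calculation have "0 < S" by linarith
    ultimately show ?thesis using K L \<rho>0[of j] \<nu>[of j] by (intro divide_left_mono mult_left_mono mult_pos_pos) auto
  qed
  ultimately have "M\<^sup>2 * L / (36 * K\<^sup>2 * S) \<le> f j" by simp
  also have "\<dots> \<le> (\<Sum>k\<in>UNIV. f k)" using f0 by (intro member_le_sum) auto
  finally have F: "M\<^sup>2 * L / (36 * K\<^sup>2 * S) \<le> (\<Sum>k\<in>UNIV. f k)" .
  have E: "(\<Sum>k\<in>UNIV. e k) \<le> (\<Sum>k\<in>UNIV. 4 / (\<rho>0 $ k * \<nu> k)) * L"
    unfolding sum_distrib_right by (intro sum_mono e)
  have "(\<Prod>k\<in>UNIV. (r $ k) ^ m k * exp (- (r $ k * V k))) \<le>
      (\<Prod>k\<in>UNIV. exp (e k - f k) * ((\<rho>0 $ k) ^ m k * exp (- (\<rho>0 $ k * V k))))"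
    unfolding e_def f_def using \<rho>0 r Vp by (intro prod_mono conjI poisson_likelihood_le) auto
  also have "\<dots> = exp ((\<Sum>k\<in>UNIV. e k) - (\<Sum>k\<in>UNIV. f k)) *
      (\<Prod>k\<in>UNIV. (\<rho>0 $ k) ^ m k * exp (- (\<rho>0 $ k * V k)))"
    by (simp add: prod.distrib exp_sum[symmetric] sum_subtractf)
  also have "\<dots> \<le> exp (((\<Sum>k\<in>UNIV. 4 / (\<rho>0 $ k * \<nu> k)) - M\<^sup>2 / (36 * K\<^sup>2 * S)) * L) *
      (\<Prod>k\<in>UNIV. (\<rho>0 $ k) ^ m k * exp (- (\<rho>0 $ k * V k)))"
    using E F \<rho>0 by (intro mult_right_mono prod_nonneg) (auto simp: left_diff_distrib less_imp_le)
  finally show ?thesis unfolding K_def S_def .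
qed

text \<open>The box extends only upwards from \<open>\<rho>0\<close>, so that the powers can be bounded irrespective of the
  counts \<open>m\<close>.\<close>

lemma poisson_likelihood_prod_ge:
  fixes \<rho>0 r :: "real ^ 'k::finite" and V :: "'k \<Rightarrow> real" and m :: "'k \<Rightarrow> nat"
  assumes \<rho>0: "\<And>k. \<rho>0 $ k > 0" and n: "n > 0" and V: "\<And>k. 0 \<le> V k" "\<And>k. V k \<le> n"
    and r: "r \<in> cbox \<rho>0 (\<rho>0 + (1 / n) *\<^sub>R One)"
  shows "exp (- real CARD('k)) * (\<Prod>k\<in>UNIV. (\<rho>0 $ k) ^ m k * exp (- (\<rho>0 $ k * V k))) \<le>
    (\<Prod>k\<in>UNIV. (r $ k) ^ m k * exp (- (r $ k * V k)))"
proof -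
  have "exp (- real CARD('k)) * (\<Prod>k\<in>UNIV. (\<rho>0 $ k) ^ m k * exp (- (\<rho>0 $ k * V k))) =
      (\<Prod>k\<in>UNIV. (\<rho>0 $ k) ^ m k * (exp (- 1) * exp (- (\<rho>0 $ k * V k))))"
    by (simp add: prod.distrib exp_of_nat_mult[symmetric] mult_ac)
  also have "\<dots> \<le> (\<Prod>k\<in>UNIV. (r $ k) ^ m k * exp (- (r $ k * V k)))"
  proof (intro prod_mono conjI mult_mono power_mono)
    fix k
    have rk: "\<rho>0 $ k \<le> r $ k" "r $ k \<le> \<rho>0 $ k + 1 / n"
      using r One_cart_nth[of k] by (auto simp: mem_box_cart dest!: spec[of _ k])
    show "\<rho>0 $ k \<le> r $ k" by fact
    \<comment> \<open>Volume at most \<open>n\<close> against side length 1 / n: moving up within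
      the box costs at most a factor exp (-1) per coordinate.\<close>
    have "(r $ k - \<rho>0 $ k) * V k \<le> 1 / n * n"
      using rk V[of k] n by (intro mult_mono) auto
    then show "exp (- 1) * exp (- (\<rho>0 $ k * V k)) \<le> exp (- (r $ k * V k))"
      unfolding exp_add[symmetric] using n by (simp add: algebra_simps)
    show "0 \<le> r $ k ^ m k" using rk \<rho>0[of k] by simp
  qed (use \<rho>0 in \<open>auto simp: less_imp_le\<close>)
  finally show ?thesis .
qed

section \<open>Posterior expectation for a fixed path of the field\<close>

text \<open>Here \<open>y\<close> is one path and \<open>L\<close> will be ln n. If some count
  deviates too much, the posterior is bounded by 1 and Chebyshev bounds the probability; otherwise
  \<open>posterior_le\<close> applies with the box as \<open>B\<close> and the likelihood at
  \<open>\<rho>0\<close> as reference.\<close>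

lemma posterior_expectation_le:
  fixes z :: "'k::finite \<Rightarrow> 'b" and y :: "'a::euclidean_space \<Rightarrow> 'b" and \<rho>0 :: "real ^ 'k"
  assumes z: "inj z" and y: "range y \<subseteq> range z" and ym: "\<And>k. y -` {z k} \<in> sets borel"
    and W: "compact W" and n: "n > 0" and Wn: "measure lborel W = n"
    and \<rho>0: "\<And>k. \<rho>0 $ k > 0" and \<nu>: "\<And>k. \<nu> k > 0"
    and V: "\<And>k. measure lborel (W \<inter> y -` {z k}) \<ge> n * \<nu> k / 2"
    and P: "poisson_process_law P (intensity W z \<rho>0 y)"
    and Pr: "prob_space Pr" "sets Pr = sets borel" "AE r in Pr. \<forall>k. r $ k \<ge> 0"
    and p: "p > 0" "emeasure Pr (cbox \<rho>0 (\<rho>0 + (1 / n) *\<^sub>R One)) \<ge> ennreal p"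
    and L: "L > 0" and M: "M \<ge> 0"
    and small: "\<And>k. M * sqrt L / sqrt n \<le> real CARD('k) * \<nu> k * \<rho>0 $ k"
  shows "(\<integral>\<^sup>+ N. posterior Pr (likelihood W z N y)
      {r. (\<Sum>k\<in>UNIV. \<bar>r $ k - \<rho>0 $ k\<bar> * \<nu> k) > M * sqrt L / sqrt n} \<partial>P) \<le>
    ennreal ((\<Sum>k\<in>UNIV. \<rho>0 $ k) / L + exp (((\<Sum>k\<in>UNIV. 4 / (\<rho>0 $ k * \<nu> k)) -
          M\<^sup>2 / (36 * (real CARD('k))\<^sup>2 * (\<Sum>k\<in>UNIV. \<rho>0 $ k * \<nu> k))) * L) /
          (exp (- real CARD('k)) * p))"
    (is "(\<integral>\<^sup>+ N. posterior Pr _ ?A \<partial>P) \<le> ennreal (_ + ?a / _)")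
proof -
  interpret prob_space P using P by (simp add: poisson_process_law_def)
  define v where "v k = measure lborel (W \<inter> y -` {z k})" for k
  \<comment> \<open>This level makes the Chebyshev bound at most \<rho>0 k / L, which still vanishes
    as \<open>L\<close> grows, while the cost 2 t^2 / (\<rho>0 k v k) in the exponent stays of order
    \<open>L\<close>.\<close>
  define t where "t = sqrt (n * L)"
  have t: "t > 0" unfolding t_def using n L by simp
  have Wb: "W \<in> sets borel" using compact_imp_closed[OF W] by auto
  have v: "0 \<le> v k" "v k \<le> n" for k
  proof -
    show "v k \<le> n" unfolding v_def Wn[symmetric] using Wb ym[of k] emeasure_compact_finite[OF W]
      by (intro measure_mono_fmeasurable) (auto simp: fmeasurable_def)
  qed (simp add: v_def)
  define Bad where "Bad k = {N. \<bar>real (npoints N (y -` {z k})) - \<rho>0 $ k * v k\<bar> > t}" for k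
  have int: "measure (intensity W z \<rho>0 y) (y -` {z k}) = \<rho>0 $ k * v k" for k
    unfolding v_def using \<rho>0 by (intro measure_intensity_level_set z y ym W) (simp add: less_imp_le)
  have Bad: "Bad k \<in> sets P" "emeasure P (Bad k) \<le> ennreal (\<rho>0 $ k / L)" for k
  proof -
    show "Bad k \<in> sets P"
      using poisson_process_chebyshev(1)[OF P ym[of k] t] unfolding Bad_def int .
    have "emeasure P (Bad k) \<le> ennreal (\<rho>0 $ k * v k / t\<^sup>2)"
      using poisson_process_chebyshev(2)[OF P ym[of k] t] unfolding Bad_def int .
    also have "\<rho>0 $ k * v k / t\<^sup>2 \<le> \<rho>0 $ k * n / t\<^sup>2"
      using v[of k] \<rho>0[of k] by (intro divide_right_mono mult_left_mono) auto
    also have "\<rho>0 $ k * n / t\<^sup>2 = \<rho>0 $ k / L" unfolding t_def using n L by simp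
    finally show "emeasure P (Bad k) \<le> ennreal (\<rho>0 $ k / L)" by (simp add: ennreal_leI)
  qed
  have good: "posterior Pr (likelihood W z N y) ?A \<le> ennreal (?a / (exp (- real CARD('k)) * p))"
    if N: "N \<notin> (\<Union>k. Bad k)" for N
  proof (rule posterior_le[OF Pr(1)])
    let ?l = "\<lambda>r. \<Prod>k\<in>UNIV. (r $ k) ^ npoints N (y -` {z k}) * exp (- (r $ k * v k))"
    have L_eq: "likelihood W z N y r = ?l r" for r
      unfolding v_def by (rule likelihood_eq_prod[OF z y ym W])
    have m: "\<bar>real (npoints N (y -` {z k})) - \<rho>0 $ k * v k\<bar> \<le> sqrt (n * L)" for k
      using N unfolding Bad_def t_def by (auto simp: not_less)
    show "?l \<rho>0 > 0" using \<rho>0 by (intro prod_pos) auto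
    show "AE r in Pr. r \<in> ?A \<longrightarrow> likelihood W z N y r \<le> ?a * ?l \<rho>0"
      using Pr(3)
    proof eventually_elim
      case (elim r)
      then show ?case unfolding L_eq
        using poisson_likelihood_prod_le[of \<rho>0 r \<nu> n L M v "\<lambda>k. npoints N (y -` {z k})"]
          \<rho>0 \<nu> n L M V m small by (auto simp: v_def less_imp_le)
    qed
    show "exp (- real CARD('k)) * ?l \<rho>0 \<le> likelihood W z N y r"
      if "r \<in> cbox \<rho>0 (\<rho>0 + (1 / n) *\<^sub>R One)" for r
      unfolding L_eq by (rule poisson_likelihood_prod_ge[OF \<rho>0 n v that])
  qed (use Pr(2) p in auto)
  \<comment> \<open>The majorant is measurable in \<open>N\<close>, so its integral splits; the
    posterior itself enters only through monotonicity.\<close>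
  have "(\<integral>\<^sup>+ N. posterior Pr (likelihood W z N y) ?A \<partial>P) \<le>
      (\<integral>\<^sup>+ N. indicator (\<Union>k. Bad k) N + ennreal (?a / (exp (- real CARD('k)) * p)) \<partial>P)"
  proof (rule nn_integral_mono)
    fix N
    show "posterior Pr (likelihood W z N y) ?A \<le>
        indicator (\<Union>k. Bad k) N + ennreal (?a / (exp (- real CARD('k)) * p))"
      using good[of N] posterior_le_1[of Pr "likelihood W z N y" ?A]
      by (cases "N \<in> (\<Union>k. Bad k)") (auto intro: order_trans)
  qed
  also have "\<dots> = emeasure P (\<Union>k. Bad k) + ennreal (?a / (exp (- real CARD('k)) * p))"
    using Bad(1) by (subst nn_integral_add) (auto simp: emeasure_space_1)
  also have "emeasure P (\<Union>k. Bad k) \<le> (\<Sum>k\<in>UNIV. emeasure P (Bad k))"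
    using Bad(1) by (intro emeasure_subadditive_finite) auto
  also have "\<dots> \<le> (\<Sum>k\<in>UNIV. ennreal (\<rho>0 $ k / L))"
    by (intro sum_mono Bad)
  also have "\<dots> = ennreal ((\<Sum>k\<in>UNIV. \<rho>0 $ k) / L)"
    using \<rho>0 L by (subst sum_ennreal) (auto simp: less_imp_le sum_divide_distrib)
  finally show ?thesis
    using \<rho>0 L p by (subst ennreal_plus) (auto intro!: divide_nonneg_pos sum_nonneg simp: less_imp_le)
qed

section \<open>Averaging over the field and choice of the constant\<close>

theorem proposition3p20:
  fixes Om :: "'w measure"
    and Z :: "real ^ 'D \<Rightarrow> 'w \<Rightarrow> real ^ 'd"
    and W :: "nat \<Rightarrow> (real ^ 'D) set"
    and z :: "'k::finite \<Rightarrow> real ^ 'd"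
    and \<nu> :: "(real ^ 'd) measure"
    and \<rho>0 :: "real ^ 'k"
    and \<kappa> :: "nat \<Rightarrow> 'w \<Rightarrow> (real ^ 'D) multiset measure"
    and Pr :: "(real ^ 'k) measure"
    and b C :: real
  assumes prob_Om: "prob_space Om"
    and z_inj: "inj z"
    and Z_meas: "(\<lambda>(x, \<omega>). Z x \<omega>) \<in> borel_measurable (borel \<Otimes>\<^sub>M Om)"
    and Z_range: "\<And>x \<omega>. \<omega> \<in> space Om \<Longrightarrow> Z x \<omega> \<in> range z"
    and Z_stationary: "stationary_field Om Z"
    and Z_ergodic: "ergodic_field Om Z"
    and Z_invariant: "\<And>x. distr Om borel (Z x) = \<nu>"
    and W_compact: "\<And>n. n \<ge> 1 \<Longrightarrow> compact (W n)"
    and W_nonempty: "\<And>n. n \<ge> 1 \<Longrightarrow> W n \<noteq> {}"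
    and W_mono: "\<And>n. n \<ge> 1 \<Longrightarrow> W n \<subseteq> W (Suc n)"
    and W_vol: "\<And>n. n \<ge> 1 \<Longrightarrow> measure lborel (W n) = real n"
    and W_ergodic: "\<And>k. AE \<omega> in Om.
          (\<lambda>n. 1 / real n * (LINT x:W n|lborel. indicator {z k} (Z x \<omega>)))
            \<longlonglongrightarrow> measure \<nu> {z k}"
    and \<rho>0_pos: "\<And>k. \<rho>0 $ k > 0"
    and \<nu>_pos: "\<And>k. measure \<nu> {z k} > 0"
    and \<kappa>_kernel: "\<And>n. n \<ge> 1 \<Longrightarrow> \<kappa> n \<in> measurable Om (prob_algebra configs)"
    and \<kappa>_poisson: "\<And>n \<omega>. n \<ge> 1 \<Longrightarrow> \<omega> \<in> space Om \<Longrightarrow>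
          poisson_process_law (\<kappa> n \<omega>) (intensity (W n) z \<rho>0 (\<lambda>x. Z x \<omega>))"
    and Pr_prob: "prob_space Pr"
    and Pr_sets: "sets Pr = sets borel"
    and Pr_nonneg: "AE r in Pr. \<forall>k. r $ k \<ge> 0"
    and Pr_ac: "absolutely_continuous lborel Pr"
    and Pr_density_pos: "\<exists>c>0. \<exists>\<epsilon>>0. AE r in lborel.
          r \<in> ball \<rho>0 \<epsilon> \<longrightarrow> RN_deriv lborel Pr r \<ge> ennreal c"
    and bC_pos: "b > 0" "C > 0"
    and Pr_tail: "\<And>k u. u > 0 \<Longrightarrow> measure Pr {r. \<bar>r $ k\<bar> > u} \<le> C * u powr (- b)"
  shows "\<forall>\<^sub>F M in at_top.
    (\<lambda>n. \<integral>\<^sup>+ (N, \<omega>).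
        posterior Pr (likelihood (W n) z N (\<lambda>x. Z x \<omega>))
          {r. (\<Sum>k\<in>UNIV. \<bar>r $ k - \<rho>0 $ k\<bar> * measure \<nu> {z k}) > M * sqrt (ln (real n)) / sqrt (real n)}
      \<partial>joint_law Om (\<kappa> n)) \<longlonglongrightarrow> 0"
proof -
  interpret Om: prob_space Om by (rule prob_Om)
  define K where "K = real CARD('k)"
  define v where "v n k \<omega> = measure lborel (W n \<inter> (\<lambda>x. Z x \<omega>) -` {z k})" for n k \<omega>
  have Z_sec: "(\<lambda>x. Z x \<omega>) -` {z k} \<in> sets borel" if "\<omega> \<in> space Om" for \<omega> k
  proof -
    have "(\<lambda>x. Z x \<omega>) \<in> borel_measurable borel"
      using measurable_compose[OF measurable_Pair2'[OF that] Z_meas] by simp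
    from measurable_sets[OF this, of "{z k}"] show ?thesis by simp
  qed
  have Wb: "W n \<in> sets borel" if "n \<ge> 1" for n
    using compact_imp_closed[OF W_compact[OF that]] by auto
  have v_eq: "(LINT x:W n|lborel. indicator {z k} (Z x \<omega>)) = v n k \<omega>" for n k \<omega>
  proof -
    have "indicat_real (W n) x *\<^sub>R indicat_real {z k} (Z x \<omega>) =
        indicator (W n \<inter> (\<lambda>x. Z x \<omega>) -` {z k}) x" for x
      by (auto simp: indicator_def)
    then show ?thesis unfolding set_lebesgue_integral_def v_def by simp
  qed
  have v_meas: "v n k \<in> borel_measurable Om" if n: "n \<ge> 1" for n k
  proof -
    have "(\<lambda>(\<omega>, x). Z x \<omega>) \<in> borel_measurable (Om \<Otimes>\<^sub>M borel)"
      using measurable_compose[OF measurable_pair_swap' Z_meas] by (simp add: case_prod_beta')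
    then have "(\<lambda>(\<omega>, x). Z x \<omega>) \<in> borel_measurable (Om \<Otimes>\<^sub>M lborel)"
      by (simp cong: measurable_cong_sets)
    then have [measurable]: "(\<lambda>p. Z (snd p) (fst p)) \<in> borel_measurable (Om \<Otimes>\<^sub>M lborel)"
      by (simp add: case_prod_beta')
    have [measurable]: "W n \<in> sets lborel" using Wb[OF n] by simp
    have "(\<lambda>\<omega>. LINT x|lborel. indicat_real (W n) x *\<^sub>R indicat_real {z k} (Z x \<omega>)) \<in> borel_measurable Om"
      by (rule lborel.borel_measurable_lebesgue_integral) (simp add: case_prod_beta')
    then show ?thesis unfolding v_eq[unfolded set_lebesgue_integral_def] .
  qed
  \<comment> \<open>Fields for which some value occupies less than half of its expected share of the
    window. Their probability vanishes by \<open>W_ergodic\<close>, and on them the posterior is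
    bounded by 1.\<close>
  define B where "B n = {\<omega> \<in> space Om. \<not> (\<forall>k. v n k \<omega> \<ge> real n * measure \<nu> {z k} / 2)}" for n
  have B_meas: "B n \<in> sets Om" if "n \<ge> 1" for n
    unfolding B_def using v_meas[OF that] by measurable
  have "AE \<omega> in Om. \<forall>k\<in>UNIV. (\<lambda>n. 1 / real n * v n k \<omega>) \<longlonglongrightarrow> measure \<nu> {z k}"
    using W_ergodic unfolding v_eq by (intro AE_finite_allI) auto
  \<comment> \<open>The index is shifted because \<open>B n\<close> is known to be measurable for n
    >= 1, whereas dominated convergence needs this for every term; \<open>LIMSEQ_imp_Suc\<close>
    undoes the shift.\<close>
  then have "AE \<omega> in Om. (\<lambda>n. indicator (B (Suc n)) \<omega> :: ennreal) \<longlonglongrightarrow> 0"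
  proof eventually_elim
    case (elim \<omega>)
    have "eventually (\<lambda>n. \<forall>k\<in>UNIV. measure \<nu> {z k} / 2 < 1 / real n * v n k \<omega>) sequentially"
    proof (rule eventually_ball_finite; safe?)
      fix k
      show "eventually (\<lambda>n. measure \<nu> {z k} / 2 < 1 / real n * v n k \<omega>) sequentially"
        using elim \<nu>_pos[of k] by (intro order_tendstoD(1)[of _ "measure \<nu> {z k}"]) auto
    qed simp
    then have "eventually (\<lambda>n. \<omega> \<notin> B n) sequentially"
      using eventually_gt_at_top[of 0]
    proof eventually_elim
      case (elim n)
      have "real n * measure \<nu> {z k} / 2 \<le> v n k \<omega>" for k
        using elim(1)[rule_format, of k] elim(2) by (simp add: field_simps)
      then show ?case by (simp add: B_def)
    qed
    then have "eventually (\<lambda>n. \<omega> \<notin> B (Suc n)) sequentially"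
      unfolding eventually_sequentially_Suc[of "\<lambda>n. \<omega> \<notin> B n"] .
    then show ?case by (intro tendsto_eventually) (auto elim!: eventually_mono)
  qed
  then have "(\<lambda>n. \<integral>\<^sup>+ \<omega>. indicator (B (Suc n)) \<omega> \<partial>Om) \<longlonglongrightarrow> (\<integral>\<^sup>+ \<omega>. 0 \<partial>Om)"
    using B_meas
    by (intro nn_integral_dominated_convergence[where w="\<lambda>_. 1"])
      (auto simp: Om.emeasure_space_1 indicator_def)
  then have "(\<lambda>n. emeasure Om (B (Suc n))) \<longlonglongrightarrow> 0" using B_meas by simp
  then have B_lim: "(\<lambda>n. emeasure Om (B n)) \<longlonglongrightarrow> 0" by (rule LIMSEQ_imp_Suc)

  define C1 S where "C1 = (\<Sum>k\<in>UNIV. 4 / (\<rho>0 $ k * measure \<nu> {z k}))"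
    and "S = (\<Sum>k\<in>UNIV. \<rho>0 $ k * measure \<nu> {z k})"
  have K: "K > 0" unfolding K_def by simp
  have S: "S > 0" unfolding S_def using \<rho>0_pos \<nu>_pos by (intro sum_pos) auto
  obtain c \<epsilon> where c: "c > 0" and \<epsilon>: "\<epsilon> > 0"
    and dens: "AE r in lborel. r \<in> ball \<rho>0 \<epsilon> \<longrightarrow> RN_deriv lborel Pr r \<ge> ennreal c"
    using Pr_density_pos by blast

  \<comment> \<open>Since M >= 1 gives M^2 >= M, the second bound makes the exponent at most -(K +
    1): \<open>K\<close> powers of \<open>n\<close> pay for the prior mass of the box, bounded below
    by c n^(-K), and the remaining one makes the term vanish.\<close>
  have "\<forall>\<^sub>F M in at_top. (M::real) \<ge> 1 \<and> M \<ge> (C1 + K + 1) * (36 * K\<^sup>2 * S)"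
    by (intro eventually_conj eventually_ge_at_top)
  then show ?thesis
  proof eventually_elim
    case (elim M)
    have M: "C1 - M\<^sup>2 / (36 * K\<^sup>2 * S) \<le> - (K + 1)"
    proof -
      have "(C1 + K + 1) * (36 * K\<^sup>2 * S) \<le> M\<^sup>2"
        using elim self_le_power[of M 2] by linarith
      then have "C1 + K + 1 \<le> M\<^sup>2 / (36 * K\<^sup>2 * S)"
        using K S by (simp add: pos_le_divide_eq)
      then show ?thesis by simp
    qed
    \<comment> \<open>The first term is the Chebyshev bound. In the second, exp K comes from the
      lower bound on the likelihood in the box and \<open>c\<close> from the bound on the prior
      density.\<close>
    define e where "e n = (\<Sum>k\<in>UNIV. \<rho>0 $ k) / ln (real n) + exp K / (c * real n)" for n
    define \<Phi> where "\<Phi> n = (\<integral>\<^sup>+ (N, \<omega>). posterior Pr (likelihood (W n) z N (\<lambda>x. Z x \<omega>))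
          {r. (\<Sum>k\<in>UNIV. \<bar>r $ k - \<rho>0 $ k\<bar> * measure \<nu> {z k}) >
            M * sqrt (ln (real n)) / sqrt (real n)} \<partial>joint_law Om (\<kappa> n))" for n
    have "(\<lambda>n. s / ln (real n) + x / (c * real n)) \<longlonglongrightarrow> 0" for s x
      using c by real_asymp
    then have e_lim: "e \<longlonglongrightarrow> 0" unfolding e_def .
    \<comment> \<open>This makes ln n positive, as \<open>posterior_expectation_le\<close> requires
      of \<open>L\<close>. The next two conditions put the box inside the ball where the prior
      density is bounded below, and provide \<open>small\<close>.\<close>
    have "eventually (\<lambda>n. n \<ge> 3) sequentially" by (rule eventually_ge_at_top)
    moreover have "eventually (\<lambda>n. K * (1 / real n) < \<epsilon>) sequentially"
      using \<epsilon> by real_asymp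
    moreover have "eventually (\<lambda>n. \<forall>k\<in>UNIV. M * sqrt (ln (real n)) / sqrt (real n) \<le>
        K * measure \<nu> {z k} * \<rho>0 $ k) sequentially"
    proof (rule eventually_ball_finite; safe?)
      fix k
      have "(\<lambda>n. M * sqrt (ln (real n)) / sqrt (real n)) \<longlonglongrightarrow> 0" by real_asymp
      moreover have "0 < K * measure \<nu> {z k} * \<rho>0 $ k" using K \<nu>_pos \<rho>0_pos by simp
      ultimately show "eventually (\<lambda>n. M * sqrt (ln (real n)) / sqrt (real n) \<le>
          K * measure \<nu> {z k} * \<rho>0 $ k) sequentially"
        by (metis (mono_tags, lifting) eventually_mono less_imp_le order_tendstoD(2))
    qed simp
    ultimately have "eventually (\<lambda>n. \<Phi> n \<le> emeasure Om (B n) + ennreal (e n)) sequentially"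
    proof eventually_elim
      case (elim n)
      then have n: "n \<ge> 1" "real n > 0" by auto
      have ln_pos: "ln (real n) > 0" using elim by simp
      have box: "emeasure Pr (cbox \<rho>0 (\<rho>0 + (1 / real n) *\<^sub>R One)) \<ge>
          ennreal (c * (1 / real n) ^ CARD('k))"
        using elim n by (intro prior_box_mass[OF Pr_sets Pr_ac dens c]) (auto simp: K_def)
      have "\<Phi> n \<le> (\<integral>\<^sup>+ \<omega>. \<integral>\<^sup>+ N. posterior Pr (likelihood (W n) z N (\<lambda>x. Z x \<omega>))
          {r. (\<Sum>k\<in>UNIV. \<bar>r $ k - \<rho>0 $ k\<bar> * measure \<nu> {z k}) >
            M * sqrt (ln (real n)) / sqrt (real n)} \<partial>\<kappa> n \<omega> \<partial>Om)"
        unfolding \<Phi>_def by (rule nn_integral_joint_law_le[OF \<kappa>_kernel[OF n(1)] Om.not_empty])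
      also have "\<dots> \<le> (\<integral>\<^sup>+ \<omega>. indicator (B n) \<omega> + ennreal (e n) \<partial>Om)"
      proof (rule nn_integral_mono)
        fix \<omega> assume w: "\<omega> \<in> space Om"
        let ?A = "{r. (\<Sum>k\<in>UNIV. \<bar>r $ k - \<rho>0 $ k\<bar> * measure \<nu> {z k}) >
            M * sqrt (ln (real n)) / sqrt (real n)}"
        let ?I = "\<integral>\<^sup>+ N. posterior Pr (likelihood (W n) z N (\<lambda>x. Z x \<omega>)) ?A \<partial>\<kappa> n \<omega>"
        show "?I \<le> indicator (B n) \<omega> + ennreal (e n)"
        proof (cases "\<omega> \<in> B n")
          case True
          have "prob_space (\<kappa> n \<omega>)"
            using \<kappa>_poisson[OF n(1) w] by (simp add: poisson_process_law_def)
          then have "?I \<le> 1"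
            using nn_integral_mono[of "\<kappa> n \<omega>" _ "\<lambda>_. 1", OF posterior_le_1]
            by (simp add: prob_space.emeasure_space_1)
          then show ?thesis using True by (auto intro: order_trans)
        next
          case False
          have "?I \<le> ennreal ((\<Sum>k\<in>UNIV. \<rho>0 $ k) / ln (real n) +
              exp ((C1 - M\<^sup>2 / (36 * K\<^sup>2 * S)) * ln (real n)) /
              (exp (- K) * (c * (1 / real n) ^ CARD('k))))"
            unfolding C1_def K_def S_def
            using False w elim \<open>M \<ge> 1 \<and> _\<close> n ln_pos c box Z_range[OF w]
            by (intro posterior_expectation_le[OF z_inj _ Z_sec[OF w] W_compact[OF n(1)] n(2)
                  W_vol[OF n(1)] \<rho>0_pos \<nu>_pos _ \<kappa>_poisson[OF n(1) w] Pr_prob Pr_sets Pr_nonneg])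
              (auto simp: B_def v_def K_def)
          also have "\<dots> \<le> ennreal (e n)"
          proof (rule ennreal_leI)
            have "exp ((C1 - M\<^sup>2 / (36 * K\<^sup>2 * S)) * ln (real n)) \<le> exp (- (K + 1) * ln (real n))"
              using M ln_pos by simp
            also have "\<dots> = exp (- (real (Suc CARD('k)) * ln (real n)))"
              unfolding K_def by (simp add: algebra_simps)
            also have "\<dots> = 1 / real n ^ Suc CARD('k)"
              using n by (simp only: exp_minus exp_of_nat_mult exp_ln inverse_eq_divide)
            finally have "exp ((C1 - M\<^sup>2 / (36 * K\<^sup>2 * S)) * ln (real n)) /
                (exp (- K) * (c * (1 / real n) ^ CARD('k))) \<le>
                1 / real n ^ Suc CARD('k) / (exp (- K) * (c * (1 / real n) ^ CARD('k)))"
              using c n by (intro divide_right_mono) auto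
            also have "\<dots> = exp K / (c * real n)"
              using c n by (simp add: exp_minus field_simps)
            finally show "(\<Sum>k\<in>UNIV. \<rho>0 $ k) / ln (real n) +
              exp ((C1 - M\<^sup>2 / (36 * K\<^sup>2 * S)) * ln (real n)) /
              (exp (- K) * (c * (1 / real n) ^ CARD('k))) \<le> e n"
              unfolding e_def by simp
          qed
          finally show ?thesis using False by simp
        qed
      qed
      also have "\<dots> = emeasure Om (B n) + ennreal (e n)"
        using B_meas[OF n(1)] by (subst nn_integral_add) (auto simp: Om.emeasure_space_1)
      finally show ?case .
    qed
    moreover have "(\<lambda>n. emeasure Om (B n) + ennreal (e n)) \<longlonglongrightarrow> 0 + ennreal 0"
      by (intro tendsto_add B_lim tendsto_ennrealI e_lim)
    ultimately have "\<Phi> \<longlonglongrightarrow> 0"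
      by (intro tendsto_sandwich[of "\<lambda>_. 0" \<Phi> sequentially _ 0]) auto
    then show ?case unfolding \<Phi>_def .
  qed
qed

end
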